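(* Let $p$ be a prime with $p \equiv 17 \pmod{60}$, let $G = \mathrm{SL}_2(\mathbb{Z}_p)$, and let $I$ be the Scharlau ideal of $G$ in $\mathbb{Z}[G]$. Then the order of $G$, i.e. the integer $|G| = (p-1)p(p+1)$ regarded as the element $|G|\cdot 1$ of $\mathbb{Z}[G]$, is an element of $I$.
   Context: $\mathbb{Z}_p = \mathbb{Z}/p\mathbb{Z}$ denotes the field with $p$ elements. For a finite group $G$ and a subset $S \subseteq G$, $\overline{S} = \sum_{s \in S} s \in \mathbb{Z}[G]$. The Scharlau ideal of $G$ is the two-sided ideal of $\mathbb{Z}[G]$ generated by the elements $\overline{H}$, where $H$ ranges over the non-trivial subgroups of $G$. The integers $\mathbb{Z}$ are identified with $\mathbb{Z}\cdot 1 \subseteq \mathbb{Z}[G]$. *)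

theory Defs
  imports "HOL-Number_Theory.Residues" "HOL-Algebra.Ideal"
begin

section \<open>The special linear group of degree two\<close>

text \<open>The quadruple \<open>(a, b, c, d)\<close> stands for the matrix with rows \<open>(a, b)\<close> and \<open>(c, d)\<close>.\<close>

definition SL2 :: "('a, 'm) ring_scheme \<Rightarrow> ('a \<times> 'a \<times> 'a \<times> 'a) monoid" where
  "SL2 R =
    \<lparr>carrier = {(a, b, c, d). a \<in> carrier R \<and> b \<in> carrier R \<and> c \<in> carrier R \<and> d \<in> carrier R \<and>
       a \<otimes>\<^bsub>R\<^esub> d \<ominus>\<^bsub>R\<^esub> b \<otimes>\<^bsub>R\<^esub> c = \<one>\<^bsub>R\<^esub>},
     monoid.mult = \<lambda>(a, b, c, d) (a', b', c', d').
       (a \<otimes>\<^bsub>R\<^esub> a' \<oplus>\<^bsub>R\<^esub> b \<otimes>\<^bsub>R\<^esub> c', a \<otimes>\<^bsub>R\<^esub> b' \<oplus>\<^bsub>R\<^esub> b \<otimes>\<^bsub>R\<^esub> d',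
        c \<otimes>\<^bsub>R\<^esub> a' \<oplus>\<^bsub>R\<^esub> d \<otimes>\<^bsub>R\<^esub> c', c \<otimes>\<^bsub>R\<^esub> b' \<oplus>\<^bsub>R\<^esub> d \<otimes>\<^bsub>R\<^esub> d'),
     one = (\<one>\<^bsub>R\<^esub>, \<zero>\<^bsub>R\<^esub>, \<zero>\<^bsub>R\<^esub>, \<one>\<^bsub>R\<^esub>)\<rparr>"

lemma (in cring) SL2_group: "group (SL2 R)"
proof (rule groupI)
  fix x y assume "x \<in> carrier (SL2 R)" "y \<in> carrier (SL2 R)"
  then obtain a b c d a' b' c' d' where xy: "x = (a, b, c, d)" "y = (a', b', c', d')"
    and [simp]: "a \<in> carrier R" "b \<in> carrier R" "c \<in> carrier R" "d \<in> carrier R"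
      "a' \<in> carrier R" "b' \<in> carrier R" "c' \<in> carrier R" "d' \<in> carrier R"
    and det: "a \<otimes> d \<ominus> b \<otimes> c = \<one>" "a' \<otimes> d' \<ominus> b' \<otimes> c' = \<one>"
    by (auto simp: SL2_def)
  let ?k = "(a \<otimes> a') \<otimes> (c \<otimes> b') \<oplus> (b \<otimes> c') \<otimes> (d \<otimes> d')"
  let ?m = "(a \<otimes> d) \<otimes> (a' \<otimes> d') \<oplus> (b \<otimes> c) \<otimes> (b' \<otimes> c')"
  let ?n = "(a \<otimes> d) \<otimes> (b' \<otimes> c') \<oplus> (b \<otimes> c) \<otimes> (a' \<otimes> d')"
  have cancel: "(k \<oplus> m) \<ominus> (k \<oplus> n) = m \<ominus> n"
    if "k \<in> carrier R" "m \<in> carrier R" "n \<in> carrier R" for k m n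
    using that by algebra
  have det_mult: "(u \<ominus> v) \<otimes> (u' \<ominus> v') = (u \<otimes> u' \<oplus> v \<otimes> v') \<ominus> (u \<otimes> v' \<oplus> v \<otimes> u')"
    if "u \<in> carrier R" "v \<in> carrier R" "u' \<in> carrier R" "v' \<in> carrier R" for u v u' v'
    using that by algebra
  have "(a \<otimes> a' \<oplus> b \<otimes> c') \<otimes> (c \<otimes> b' \<oplus> d \<otimes> d') = ?k \<oplus> ?m"
    by (simp add: l_distr r_distr a_ac m_ac)
  moreover have "(a \<otimes> b' \<oplus> b \<otimes> d') \<otimes> (c \<otimes> a' \<oplus> d \<otimes> c') = ?k \<oplus> ?n"
    by (simp add: l_distr r_distr a_ac m_ac)
  ultimately have "(a \<otimes> a' \<oplus> b \<otimes> c') \<otimes> (c \<otimes> b' \<oplus> d \<otimes> d') \<ominus> (a \<otimes> b' \<oplus> b \<otimes> d') \<otimes> (c \<otimes> a' \<oplus> d \<otimes> c')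
      = ?m \<ominus> ?n"
    by (simp add: cancel)
  also have "\<dots> = (a \<otimes> d \<ominus> b \<otimes> c) \<otimes> (a' \<otimes> d' \<ominus> b' \<otimes> c')"
    by (simp add: det_mult)
  also have "\<dots> = \<one>"
    by (simp add: det)
  finally show "x \<otimes>\<^bsub>SL2 R\<^esub> y \<in> carrier (SL2 R)"
    by (simp add: xy SL2_def)
next
  show "\<one>\<^bsub>SL2 R\<^esub> \<in> carrier (SL2 R)"
    by (simp add: SL2_def) algebra
next
  fix x y z
  assume "x \<in> carrier (SL2 R)" "y \<in> carrier (SL2 R)" "z \<in> carrier (SL2 R)"
  then show "x \<otimes>\<^bsub>SL2 R\<^esub> y \<otimes>\<^bsub>SL2 R\<^esub> z = x \<otimes>\<^bsub>SL2 R\<^esub> (y \<otimes>\<^bsub>SL2 R\<^esub> z)"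
    by (auto simp: SL2_def l_distr r_distr m_assoc a_ac)
next
  fix x assume "x \<in> carrier (SL2 R)"
  then show "\<one>\<^bsub>SL2 R\<^esub> \<otimes>\<^bsub>SL2 R\<^esub> x = x"
    by (auto simp: SL2_def)
next
  fix x assume "x \<in> carrier (SL2 R)"
  then obtain a b c d where x: "x = (a, b, c, d)"
    and [simp]: "a \<in> carrier R" "b \<in> carrier R" "c \<in> carrier R" "d \<in> carrier R"
    and det: "a \<otimes> d \<ominus> b \<otimes> c = \<one>"
    by (auto simp: SL2_def)
  have eqs: "d \<otimes> a \<oplus> (\<ominus> b) \<otimes> c = a \<otimes> d \<ominus> b \<otimes> c" "d \<otimes> b \<oplus> (\<ominus> b) \<otimes> d = \<zero>"
    "(\<ominus> c) \<otimes> a \<oplus> a \<otimes> c = \<zero>" "(\<ominus> c) \<otimes> b \<oplus> a \<otimes> d = a \<otimes> d \<ominus> b \<otimes> c"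
    "d \<otimes> a \<ominus> (\<ominus> b) \<otimes> (\<ominus> c) = a \<otimes> d \<ominus> b \<otimes> c"
    by (simp_all add: a_minus_def l_minus r_minus l_neg r_neg a_comm m_comm[of d] m_comm[of c a]
        m_comm[of c b])
  show "\<exists>y \<in> carrier (SL2 R). y \<otimes>\<^bsub>SL2 R\<^esub> x = \<one>\<^bsub>SL2 R\<^esub>"
    by (rule bexI[of _ "(d, \<ominus> b, \<ominus> c, a)"]) (simp_all add: x SL2_def eqs det)
qed


section \<open>The integral group ring of a finite group\<close>

text \<open>
  An element \<open>f\<close> of the group ring is given by its coefficients \<open>f g\<close>; these are required to vanish
  outside the carrier, so that equality of elements is equality of functions. No finiteness of
  the support is imposed, hence this is the group ring only for finite \<open>G\<close>.
\<close>

definition int_group_ring :: "('g, 'm) monoid_scheme \<Rightarrow> ('g \<Rightarrow> int) ring" where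
  "int_group_ring G =
    \<lparr>carrier = {f. \<forall>x. x \<notin> carrier G \<longrightarrow> f x = 0},
     monoid.mult = \<lambda>f g z.
       \<Sum>(x, y) \<in> {(x, y) \<in> carrier G \<times> carrier G. x \<otimes>\<^bsub>G\<^esub> y = z}. f x * g y,
     one = \<lambda>x. if x = \<one>\<^bsub>G\<^esub> then 1 else 0,
     zero = \<lambda>x. 0,
     add = \<lambda>f g x. f x + g x\<rparr>"

definition grp_elem :: "'g \<Rightarrow> 'g \<Rightarrow> int" where
  "grp_elem s = (\<lambda>x. if x = s then 1 else 0)"

definition subset_sum :: "('g, 'm) monoid_scheme \<Rightarrow> 'g set \<Rightarrow> ('g \<Rightarrow> int)" where
  "subset_sum G S = (\<Oplus>\<^bsub>int_group_ring G\<^esub> s \<in> S. grp_elem s)"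

definition scharlau_ideal :: "('g, 'm) monoid_scheme \<Rightarrow> ('g \<Rightarrow> int) set" where
  "scharlau_ideal G =
    Idl\<^bsub>int_group_ring G\<^esub> {subset_sum G H | H. subgroup H G \<and> H \<noteq> {\<one>\<^bsub>G\<^esub>}}"

lemma int_group_ring_mult_eq:
  assumes "finite (carrier G)"
  shows "(f \<otimes>\<^bsub>int_group_ring G\<^esub> g) z =
    (\<Sum>x \<in> carrier G. \<Sum>y \<in> carrier G. if x \<otimes>\<^bsub>G\<^esub> y = z then f x * g y else 0)"
proof -
  have "(f \<otimes>\<^bsub>int_group_ring G\<^esub> g) z =
    (\<Sum>(x, y) \<in> {xy \<in> carrier G \<times> carrier G. fst xy \<otimes>\<^bsub>G\<^esub> snd xy = z}. f x * g y)"
    by (auto simp: int_group_ring_def intro!: sum.cong)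
  also have "\<dots> = (\<Sum>xy \<in> carrier G \<times> carrier G.
      if fst xy \<otimes>\<^bsub>G\<^esub> snd xy = z then f (fst xy) * g (snd xy) else 0)"
    using assms by (simp add: sum.inter_filter case_prod_unfold)
  finally show ?thesis
    by (simp add: sum.cartesian_product case_prod_unfold)
qed

lemma int_group_ring_simps:
  "carrier (int_group_ring G) = {f. \<forall>x. x \<notin> carrier G \<longrightarrow> f x = 0}"
  "\<one>\<^bsub>int_group_ring G\<^esub> = grp_elem \<one>\<^bsub>G\<^esub>"
  "\<zero>\<^bsub>int_group_ring G\<^esub> = (\<lambda>x. 0)"
  "f \<oplus>\<^bsub>int_group_ring G\<^esub> g = (\<lambda>x. f x + g x)"
  by (simp_all add: int_group_ring_def grp_elem_def)

lemma (in group) int_group_ring_ring: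
  assumes fin: "finite (carrier G)"
  shows "ring (int_group_ring G)"
proof (rule ringI)
  show "abelian_group (int_group_ring G)"
  proof (rule abelian_groupI)
    fix f assume "f \<in> carrier (int_group_ring G)"
    then show "\<exists>g \<in> carrier (int_group_ring G).
        g \<oplus>\<^bsub>int_group_ring G\<^esub> f = \<zero>\<^bsub>int_group_ring G\<^esub>"
      by (intro bexI[of _ "\<lambda>x. - f x"]) (auto simp: int_group_ring_simps)
  qed (auto simp: int_group_ring_simps)
next
  have mult_closed: "f \<otimes>\<^bsub>int_group_ring G\<^esub> g \<in> carrier (int_group_ring G)" for f g
    by (auto simp: int_group_ring_simps int_group_ring_mult_eq[OF fin] intro!: sum.neutral)
  have coeff: "(\<Sum>w \<in> carrier G. if v = w then h w else 0) = h v" if "v \<in> carrier G" for v and h :: "'a \<Rightarrow> int"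
    using that fin by (simp add: sum.delta')
  have assoc: "((f \<otimes>\<^bsub>int_group_ring G\<^esub> g) \<otimes>\<^bsub>int_group_ring G\<^esub> h) z
      = (f \<otimes>\<^bsub>int_group_ring G\<^esub> (g \<otimes>\<^bsub>int_group_ring G\<^esub> h)) z" for f g h z
  proof -
    have "((f \<otimes>\<^bsub>int_group_ring G\<^esub> g) \<otimes>\<^bsub>int_group_ring G\<^esub> h) z =
      (\<Sum>w \<in> carrier G. \<Sum>y \<in> carrier G. \<Sum>u \<in> carrier G. \<Sum>v \<in> carrier G.
        if u \<otimes> v = w then if w \<otimes> y = z then f u * g v * h y else 0 else 0)"
      unfolding int_group_ring_mult_eq[OF fin]
      by (intro sum.cong refl) (auto simp: sum_distrib_right intro!: sum.cong sum.neutral)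
    also have "\<dots> = (\<Sum>y \<in> carrier G. \<Sum>u \<in> carrier G. \<Sum>v \<in> carrier G. \<Sum>w \<in> carrier G.
        if u \<otimes> v = w then if w \<otimes> y = z then f u * g v * h y else 0 else 0)"
      by (rule trans[OF sum.swap], rule sum.cong[OF refl], rule trans[OF sum.swap],
          rule sum.cong[OF refl], rule sum.swap)
    also have "\<dots> = (\<Sum>y \<in> carrier G. \<Sum>u \<in> carrier G. \<Sum>v \<in> carrier G.
        if u \<otimes> v \<otimes> y = z then f u * g v * h y else 0)"
      by (intro sum.cong refl coeff) simp
    also have "\<dots> = (\<Sum>u \<in> carrier G. \<Sum>v \<in> carrier G. \<Sum>y \<in> carrier G.
        if u \<otimes> v \<otimes> y = z then f u * g v * h y else 0)"
      by (rule trans[OF sum.swap], rule sum.cong[OF refl], rule sum.swap)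
    also have "\<dots> = (\<Sum>u \<in> carrier G. \<Sum>v \<in> carrier G. \<Sum>y \<in> carrier G. \<Sum>w \<in> carrier G.
        if v \<otimes> y = w then if u \<otimes> w = z then f u * (g v * h y) else 0 else 0)"
      by (intro sum.cong refl, subst coeff) (simp_all add: m_assoc mult.assoc)
    also have "\<dots> = (\<Sum>u \<in> carrier G. \<Sum>w \<in> carrier G. \<Sum>v \<in> carrier G. \<Sum>y \<in> carrier G.
        if v \<otimes> y = w then if u \<otimes> w = z then f u * (g v * h y) else 0 else 0)"
      by (rule sum.cong[OF refl], rule sym, rule trans[OF sum.swap], rule sum.cong[OF refl],
          rule sum.swap)
    also have "\<dots> = (f \<otimes>\<^bsub>int_group_ring G\<^esub> (g \<otimes>\<^bsub>int_group_ring G\<^esub> h)) z"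
      unfolding int_group_ring_mult_eq[OF fin]
      by (intro sum.cong refl) (auto simp: sum_distrib_left intro!: sum.cong sum.neutral)
    finally show ?thesis .
  qed
  have l_one: "(\<one>\<^bsub>int_group_ring G\<^esub> \<otimes>\<^bsub>int_group_ring G\<^esub> f) z = f z"
    if f: "f \<in> carrier (int_group_ring G)" for f z
  proof -
    have "(\<one>\<^bsub>int_group_ring G\<^esub> \<otimes>\<^bsub>int_group_ring G\<^esub> f) z =
      (\<Sum>x \<in> carrier G. if x = \<one> then \<Sum>y \<in> carrier G. if y = z then f y else 0 else 0)"
      by (auto simp: int_group_ring_mult_eq[OF fin] int_group_ring_simps grp_elem_def
          intro!: sum.cong sum.neutral)
    then show ?thesis
      using f fin by (auto simp: int_group_ring_simps)
  qed
  have r_one: "(f \<otimes>\<^bsub>int_group_ring G\<^esub> \<one>\<^bsub>int_group_ring G\<^esub>) z = f z"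
    if f: "f \<in> carrier (int_group_ring G)" for f z
  proof -
    have "(f \<otimes>\<^bsub>int_group_ring G\<^esub> \<one>\<^bsub>int_group_ring G\<^esub>) z =
      (\<Sum>x \<in> carrier G. \<Sum>y \<in> carrier G. if y = \<one> then if x = z then f x else 0 else 0)"
      by (auto simp: int_group_ring_mult_eq[OF fin] int_group_ring_simps grp_elem_def
          intro!: sum.cong sum.neutral)
    then show ?thesis
      using f fin by (auto simp: int_group_ring_simps)
  qed
  show "monoid (int_group_ring G)"
    by (rule monoidI) (auto intro!: mult_closed ext assoc l_one r_one,
        auto simp: int_group_ring_simps grp_elem_def)
next
  fix f g h
  show "(f \<oplus>\<^bsub>int_group_ring G\<^esub> g) \<otimes>\<^bsub>int_group_ring G\<^esub> h =
    (f \<otimes>\<^bsub>int_group_ring G\<^esub> h) \<oplus>\<^bsub>int_group_ring G\<^esub> (g \<otimes>\<^bsub>int_group_ring G\<^esub> h)"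
    by (auto simp: int_group_ring_def algebra_simps sum.distrib case_prod_unfold)
  show "h \<otimes>\<^bsub>int_group_ring G\<^esub> (f \<oplus>\<^bsub>int_group_ring G\<^esub> g) =
    (h \<otimes>\<^bsub>int_group_ring G\<^esub> f) \<oplus>\<^bsub>int_group_ring G\<^esub> (h \<otimes>\<^bsub>int_group_ring G\<^esub> g)"
    by (auto simp: int_group_ring_def algebra_simps sum.distrib case_prod_unfold)
qed

lemma (in group) grp_elem_mult:
  assumes "finite (carrier G)" "s \<in> carrier G" "t \<in> carrier G"
  shows "grp_elem s \<otimes>\<^bsub>int_group_ring G\<^esub> grp_elem t = grp_elem (s \<otimes> t)"
proof
  fix z
  have "(grp_elem s \<otimes>\<^bsub>int_group_ring G\<^esub> grp_elem t) z =
    (\<Sum>x \<in> carrier G. if x = s then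
      \<Sum>y \<in> carrier G. if y = t then if z = s \<otimes> t then 1 else 0 else 0 else 0)"
    by (auto simp: int_group_ring_mult_eq[OF assms(1)] grp_elem_def intro!: sum.cong sum.neutral)
  then show "(grp_elem s \<otimes>\<^bsub>int_group_ring G\<^esub> grp_elem t) z = grp_elem (s \<otimes> t) z"
    using assms by (simp add: grp_elem_def)
qed

lemma (in group) subset_sum_eq:
  assumes fin: "finite (carrier G)" and S: "S \<subseteq> carrier G"
  shows "subset_sum G S = (\<lambda>x. if x \<in> S then 1 else 0)"
proof -
  interpret R: ring "int_group_ring G"
    by (rule int_group_ring_ring[OF fin])
  have "finite S"
    using S fin by (rule finite_subset)
  then show ?thesis
    using S
  proof (induction S)
    case empty
    then show ?case by (simp add: subset_sum_def int_group_ring_simps)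
  next
    case (insert s S)
    have "subset_sum G (insert s S) = grp_elem s \<oplus>\<^bsub>int_group_ring G\<^esub> subset_sum G S"
      unfolding subset_sum_def using insert
      by (intro R.finsum_insert) (auto simp: int_group_ring_simps grp_elem_def)
    with insert show ?case
      by (auto simp: int_group_ring_simps grp_elem_def)
  qed
qed

end

theory Submission
  imports Defs "HOL-Library.Function_Algebras"
begin

text \<open>
  The idea is to average over the conjugation action of \<open>GL2\<close>, which is larger than \<open>SL2\<close> and
  sees nothing but traces. For \<open>b\<close> in \<open>SL2\<close> let \<open>conj_sum b\<close> be the sum of \<open>g b g\<inverse>\<close> over all \<open>g\<close>
  in \<open>GL2\<close>. If \<open>b\<close> is not scalar, then \<open>b\<close> is conjugate in \<open>GL2\<close> to the companion matrix of
  its characteristic polynomial, hence \<open>conj_sum b\<close> depends only on the trace \<open>s\<close> of \<open>b\<close>; call it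
  \<open>trace_sum s\<close> (lemma \<open>conj_sum_eq_trace_sum\<close>). Whenever \<open>H\<close> is a non-trivial subgroup of \<open>SL2\<close>,
  the sum of \<open>conj_sum (h b)\<close> over \<open>h \<in> H\<close> lies in the Scharlau ideal, because each
  \<open>g H g\<inverse>\<close> is again a non-trivial subgroup. Suitable choices of \<open>H\<close> give, modulo the ideal:

  \<^item> \<open>H = {1, -1}\<close>: \<open>trace_sum s + trace_sum (- s) = 0\<close>.

  \<^item> \<open>H\<close> unipotent and \<open>b\<close> diagonal with distinct entries \<open>e\<close>, \<open>f\<close>: the coset \<open>H b\<close> is just the
    set of \<open>H\<close>-conjugates of \<open>b\<close>, and therefore \<open>trace_sum t = 0\<close> for \<open>t = e + f\<close>.

  \<^item> \<open>H = {1, x, x\<^sup>2}\<close> with \<open>x\<close> of trace \<open>- 1\<close>: since \<open>1 + x + x\<^sup>2 = 0\<close> as matrices, the traces of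
    \<open>b\<close>, \<open>x b\<close>, \<open>x\<^sup>2 b\<close> add up to zero. With \<open>b\<close> diagonal as before, \<open>x\<close> can be chosen such that
    these traces are \<open>t\<close>, \<open>s\<close> and \<open>- (s + t)\<close> for any given \<open>s\<close>. Together with the two previous
    relations, \<open>trace_sum s = trace_sum (s + t)\<close>.

  Over a prime field every element is a multiple of a non-zero \<open>t\<close>, so all \<open>trace_sum s\<close> vanish
  modulo the ideal. On the other hand, \<open>GL2\<close> is the product of \<open>SL2\<close> and the matrices
  \<open>diag (1, e)\<close>, and the latter permute the non-trivial elements of the lower unipotent group \<open>U\<close>
  transitively by conjugation. Hence \<open>trace_sum 2\<close> is the sum of \<open>g (\<Sum>U - 1) g\<inverse>\<close> over \<open>g\<close> in
  \<open>SL2\<close>, which is congruent to \<open>- |SL2|\<close>. As it is also congruent to zero, the order of \<open>SL2\<close>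
  lies in the ideal.
\<close>

section \<open>The Scharlau ideal of a finite group\<close>

lemma (in group) subset_sum_closed:
  assumes "finite (carrier G)" "S \<subseteq> carrier G"
  shows "subset_sum G S \<in> carrier (int_group_ring G)"
  using assms(2) by (auto simp: subset_sum_eq[OF assms] int_group_ring_simps)

lemma (in group) scharlau_ideal_ideal:
  assumes "finite (carrier G)"
  shows "ideal (scharlau_ideal G) (int_group_ring G)"
proof -
  interpret R: ring "int_group_ring G" by (rule int_group_ring_ring[OF assms])
  show ?thesis unfolding scharlau_ideal_def
    by (rule R.genideal_ideal) (auto intro!: subset_sum_closed[OF assms] dest: subgroup.subset)
qed

lemma (in group) scharlau_ideal_add:
  assumes "finite (carrier G)" "f \<in> scharlau_ideal G" "g \<in> scharlau_ideal G"
  shows "f + g \<in> scharlau_ideal G"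
proof -
  interpret ideal "scharlau_ideal G" "int_group_ring G" by (rule scharlau_ideal_ideal[OF assms(1)])
  note additive = additive_subgroup_axioms
  show ?thesis using additive_subgroup.a_closed[OF additive assms(2,3)] by (simp add: int_group_ring_simps plus_fun_def)
qed

lemma (in group) scharlau_ideal_uminus:
  assumes "finite (carrier G)" "f \<in> scharlau_ideal G"
  shows "- f \<in> scharlau_ideal G"
proof -
  interpret ideal "scharlau_ideal G" "int_group_ring G" by (rule scharlau_ideal_ideal[OF assms(1)])
  note additive = additive_subgroup_axioms
  have f: "f \<in> carrier (int_group_ring G)" using assms(2) by (rule Icarr)
  have "\<ominus>\<^bsub>int_group_ring G\<^esub> f = - f"
    using f by (intro minus_equality) (auto simp: int_group_ring_simps)
  moreover have "\<ominus>\<^bsub>int_group_ring G\<^esub> f \<in> scharlau_ideal G"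
    using additive_subgroup.a_inv_closed[OF additive assms(2)] .
  ultimately show ?thesis by simp
qed

lemma (in group) scharlau_ideal_diff:
  assumes "finite (carrier G)" "f \<in> scharlau_ideal G" "g \<in> scharlau_ideal G"
  shows "f - g \<in> scharlau_ideal G"
  using scharlau_ideal_add[OF assms(1,2) scharlau_ideal_uminus[OF assms(1,3)]] by simp

lemma (in group) scharlau_ideal_sum:
  assumes "finite (carrier G)" "\<And>i. i \<in> A \<Longrightarrow> f i \<in> scharlau_ideal G"
  shows "sum f A \<in> scharlau_ideal G"
proof -
  interpret ideal "scharlau_ideal G" "int_group_ring G" by (rule scharlau_ideal_ideal[OF assms(1)])
  note additive = additive_subgroup_axioms
  have "0 \<in> scharlau_ideal G"
    using additive_subgroup.zero_closed[OF additive] by (simp add: int_group_ring_simps zero_fun_def)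
  with assms(2) show ?thesis
    by (induction A rule: infinite_finite_induct) (auto intro: scharlau_ideal_add[OF assms(1)])
qed

lemma (in group) subgroup_translate:
  assumes fin: "finite (carrier G)" and H: "subgroup H G" "H \<noteq> {\<one>}" and b: "b \<in> carrier G"
  shows "(\<Sum>h\<in>H. grp_elem (h \<otimes> b)) \<in> scharlau_ideal G"
proof -
  interpret ideal "scharlau_ideal G" "int_group_ring G" by (rule scharlau_ideal_ideal[OF fin])
  have gc: "grp_elem x \<in> carrier (int_group_ring G)" if "x \<in> carrier G" for x
    using that by (auto simp: int_group_ring_simps grp_elem_def)
  have sub: "H \<subseteq> carrier G" using H(1) by (rule subgroup.subset)
  have finH: "finite H" using finite_subset[OF sub fin] .
  have S: "subset_sum G S \<otimes>\<^bsub>int_group_ring G\<^esub> grp_elem b = (\<Sum>h\<in>S. grp_elem (h \<otimes> b))"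
    if "finite S" "S \<subseteq> carrier G" for S
    using that
  proof (induction S)
    case empty
    then show ?case
      using l_null[OF gc[OF b]] by (simp add: subset_sum_def int_group_ring_simps zero_fun_def)
  next
    case (insert s S)
    have "subset_sum G (insert s S) = grp_elem s \<oplus>\<^bsub>int_group_ring G\<^esub> subset_sum G S"
      using insert by (auto simp: subset_sum_eq[OF fin] int_group_ring_simps grp_elem_def)
    moreover have "subset_sum G S \<in> carrier (int_group_ring G)"
      using insert by (auto simp: subset_sum_eq[OF fin] int_group_ring_simps)
    ultimately show ?case
      using insert b
      by (simp add: l_distr gc grp_elem_mult[OF fin]) (simp add: int_group_ring_simps plus_fun_def)
  qed
  have "{subset_sum G H |H. subgroup H G \<and> H \<noteq> {\<one>}} \<subseteq> scharlau_ideal G"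
    unfolding scharlau_ideal_def
    by (rule genideal_self) (auto intro!: subset_sum_closed[OF fin] dest: subgroup.subset)
  then have "subset_sum G H \<in> scharlau_ideal G"
    using H by auto
  then have "subset_sum G H \<otimes>\<^bsub>int_group_ring G\<^esub> grp_elem b \<in> scharlau_ideal G"
    using gc[OF b] by (rule I_r_closed)
  then show ?thesis by (simp add: S[OF finH sub])
qed

section \<open>Sums over conjugates\<close>

text \<open>
  The conjugating elements range over a group \<open>L\<close> in which the group of interest is a normal
  subgroup \<open>N\<close>: elements of \<open>N\<close> that are conjugate only in \<open>L\<close> get identified.
\<close>

locale finite_normal = normal N L for N and L (structure) +
  assumes fin: "finite (carrier L)"
begin

abbreviation "G \<equiv> L\<lparr>carrier := N\<rparr>"

definition conj_by :: "'a \<Rightarrow> 'a \<Rightarrow> 'a" where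
  "conj_by g b = g \<otimes> b \<otimes> inv g"

definition conj_sum :: "'a \<Rightarrow> 'a \<Rightarrow> int" where
  "conj_sum b = (\<Sum>g\<in>carrier L. grp_elem (conj_by g b))"

lemma group_G: "group G"
  by (rule subgroup_is_group[OF group_axioms])

lemma fin_G: "finite (carrier G)"
  using finite_subset[OF subset fin] by simp

lemma conj_by_closed [simp]: "g \<in> carrier L \<Longrightarrow> b \<in> N \<Longrightarrow> conj_by g b \<in> N"
  unfolding conj_by_def by (rule inv_op_closed2)

lemma conj_by_mult:
  assumes "g \<in> carrier L" "b \<in> carrier L" "c \<in> carrier L"
  shows "conj_by g (b \<otimes> c) = conj_by g b \<otimes> conj_by g c"
proof -
  have "conj_by g b \<otimes> conj_by g c = g \<otimes> b \<otimes> (inv g \<otimes> g) \<otimes> c \<otimes> inv g"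
    using assms by (simp only: conj_by_def m_assoc inv_closed m_closed)
  also have "\<dots> = conj_by g (b \<otimes> c)"
    using assms by (simp only: l_inv) (simp add: conj_by_def m_assoc)
  finally show ?thesis by simp
qed

lemma conj_by_conj_by:
  assumes "g \<in> carrier L" "h \<in> carrier L" "b \<in> carrier L"
  shows "conj_by g (conj_by h b) = conj_by (g \<otimes> h) b"
  using assms by (simp add: conj_by_def m_assoc inv_mult_group)

lemma conj_by_one [simp]: "g \<in> carrier L \<Longrightarrow> conj_by g \<one> = \<one>"
  by (simp add: conj_by_def)

lemma conj_by_inj: "g \<in> carrier L \<Longrightarrow> inj_on (conj_by g) (carrier L)"
  by (rule inj_onI) (simp add: conj_by_def)

lemma conj_subgroup:
  assumes g: "g \<in> carrier L" and H: "subgroup H G"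
  shows "subgroup (conj_by g ` H) G"
proof -
  have "group_hom G G (conj_by g)"
    using g by (intro group_hom.intro group_G group_hom_axioms.intro homI) (auto simp: conj_by_mult)
  then show ?thesis using H by (rule group_hom.subgroup_img_is_subgroup)
qed

lemma conjugate_subgroup_translate:
  assumes g: "g \<in> carrier L" and H: "subgroup H G" "H \<noteq> {\<one>}" and b: "b \<in> N"
  shows "(\<Sum>h\<in>H. grp_elem (conj_by g (h \<otimes> b))) \<in> scharlau_ideal G"
proof -
  have sub: "H \<subseteq> N" using subgroup.subset[OF H(1)] by simp
  have one: "\<one> \<in> H" using subgroup.one_closed[OF H(1)] by simp
  have inj: "inj_on (conj_by g) H"
    using conj_by_inj[OF g] sub subset by (meson inj_on_subset)
  have "conj_by g ` H \<noteq> {\<one>}"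
    using H(2) one inj g by (metis conj_by_one image_insert image_empty inj_on_image_eq_iff subset_refl empty_subsetI insert_subset)
  then have "(\<Sum>h\<in>conj_by g ` H. grp_elem (h \<otimes>\<^bsub>G\<^esub> conj_by g b)) \<in> scharlau_ideal G"
    using g b by (intro group.subgroup_translate[OF group_G fin_G] conj_subgroup H) auto
  also have "(\<Sum>h\<in>conj_by g ` H. grp_elem (h \<otimes>\<^bsub>G\<^esub> conj_by g b)) = (\<Sum>h\<in>H. grp_elem (conj_by g (h \<otimes> b)))"
    unfolding sum.reindex[OF inj] using g b sub
    by (intro sum.cong refl) (auto simp: conj_by_mult)
  finally show ?thesis .
qed

lemma conj_sum_subgroup_translate:
  assumes H: "subgroup H G" "H \<noteq> {\<one>}" and b: "b \<in> N"
  shows "(\<Sum>h\<in>H. conj_sum (h \<otimes> b)) \<in> scharlau_ideal G"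
proof -
  have "(\<Sum>h\<in>H. conj_sum (h \<otimes> b)) = (\<Sum>g\<in>carrier L. \<Sum>h\<in>H. grp_elem (conj_by g (h \<otimes> b)))"
    unfolding conj_sum_def by (rule sum.swap)
  then show ?thesis
    using assms by (simp add: group.scharlau_ideal_sum[OF group_G fin_G] conjugate_subgroup_translate)
qed

lemma conj_sum_conj_by:
  assumes h: "h \<in> carrier L" and b: "b \<in> carrier L"
  shows "conj_sum (conj_by h b) = conj_sum b"
proof -
  have "conj_sum (conj_by h b) = (\<Sum>g\<in>carrier L. grp_elem (conj_by (g \<otimes> h) b))"
    unfolding conj_sum_def using assms by (intro sum.cong refl) (simp add: conj_by_conj_by)
  also have "\<dots> = conj_sum b"
    unfolding conj_sum_def
    by (rule sum.reindex_bij_witness[of _ "\<lambda>g. g \<otimes> inv h" "\<lambda>g. g \<otimes> h"])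
      (use h in \<open>auto simp: m_assoc\<close>)
  finally show ?thesis .
qed

text \<open>
  A factorization \<open>L = T W\<close> lets one first sum over the \<open>W\<close>-conjugates of \<open>b\<close>. If these form a
  coset of a subgroup, then already the inner sums lie in the ideal, and no multiplicity is lost.
\<close>

lemma conj_sum_factor:
  assumes bij: "bij_betw (\<lambda>(g, w). g \<otimes> w) (T \<times> W) (carrier L)"
    and T: "T \<subseteq> carrier L" and W: "W \<subseteq> carrier L" and b: "b \<in> carrier L"
  shows "conj_sum b = (\<Sum>g\<in>T. \<Sum>w\<in>W. grp_elem (conj_by g (conj_by w b)))"
proof -
  have "conj_sum b = (\<Sum>(g, w)\<in>T \<times> W. grp_elem (conj_by (g \<otimes> w) b))"
    unfolding conj_sum_def
    by (subst sum.reindex_bij_betw[OF bij, symmetric]) (simp add: case_prod_unfold)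
  also have "\<dots> = (\<Sum>g\<in>T. \<Sum>w\<in>W. grp_elem (conj_by (g \<otimes> w) b))"
    by (rule sum.cartesian_product[symmetric])
  also have "\<dots> = (\<Sum>g\<in>T. \<Sum>w\<in>W. grp_elem (conj_by g (conj_by w b)))"
    using T W b by (intro sum.cong refl) (simp add: conj_by_conj_by subset_iff)
  finally show ?thesis .
qed

end

lemma (in group) transversal_exists:
  assumes U: "subgroup U G" 
  obtains T where "T \<subseteq> carrier G" "bij_betw (\<lambda>(g, w). g \<otimes> w) (T \<times> U) (carrier G)"
proof -
  define rep where "rep C = (SOME g. g \<in> C)" for C :: "'a set"
  have sub: "U \<subseteq> carrier G" using subgroup.subset[OF U] .
  define T where "T = (\<lambda>g. rep (g <#\<^bsub>G\<^esub> U)) ` carrier G"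
  have in_self: "g \<in> g <#\<^bsub>G\<^esub> U" if "g \<in> carrier G" for g
    using that subgroup.one_closed[OF U] by (force simp: l_coset_def)
  have rep: "rep (g <#\<^bsub>G\<^esub> U) \<in> g <#\<^bsub>G\<^esub> U" if "g \<in> carrier G" for g
    unfolding rep_def using in_self[OF that] by (rule someI)
  have eq: "h <#\<^bsub>G\<^esub> U = g <#\<^bsub>G\<^esub> U" if "h \<in> g <#\<^bsub>G\<^esub> U" "g \<in> carrier G" for g h
    using l_repr_independence[OF that U] by simp
  have car: "h \<in> carrier G" if "h \<in> g <#\<^bsub>G\<^esub> U" "g \<in> carrier G" for g h
    using that sub by (auto simp: l_coset_def)
  have TT: "t \<in> carrier G" "rep (t <#\<^bsub>G\<^esub> U) = t" if "t \<in> T" for t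
    using that rep eq[OF rep] car[OF rep] by (auto simp: T_def)
  have "bij_betw (\<lambda>(g, w). g \<otimes> w) (T \<times> U) (carrier G)"
  proof (rule bij_betw_imageI)
    show "inj_on (\<lambda>(g, w). g \<otimes> w) (T \<times> U)"
    proof (rule inj_onI, clarify)
      fix s u t v assume *: "s \<in> T" "u \<in> U" "t \<in> T" "v \<in> U" "s \<otimes> u = t \<otimes> v"
      have "s \<otimes> u \<in> s <#\<^bsub>G\<^esub> U" "t \<otimes> v \<in> t <#\<^bsub>G\<^esub> U"
        using *(2,4) by (auto simp only: l_coset_def)
      then have "s <#\<^bsub>G\<^esub> U = t <#\<^bsub>G\<^esub> U" using *(5) eq TT(1)[OF *(1)] TT(1)[OF *(3)] by metis
      then have "s = t" using TT(2) * by metis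
      then show "s = t \<and> u = v" using * TT(1) sub by (simp add: subset_iff)
    qed
    show "(\<lambda>(g, w). g \<otimes> w) ` (T \<times> U) = carrier G"
    proof
      show "(\<lambda>(g, w). g \<otimes> w) ` (T \<times> U) \<subseteq> carrier G" using TT sub by auto
      show "carrier G \<subseteq> (\<lambda>(g, w). g \<otimes> w) ` (T \<times> U)"
      proof
        fix g assume g: "g \<in> carrier G"
        let ?t = "rep (g <#\<^bsub>G\<^esub> U)"
        have "?t \<in> T" using g by (auto simp: T_def)
        moreover have "g \<in> ?t <#\<^bsub>G\<^esub> U" using eq[OF rep] g in_self by simp
        ultimately show "g \<in> (\<lambda>(g, w). g \<otimes> w) ` (T \<times> U)"
          by (force simp: l_coset_def)
      qed
    qed
  qed
  moreover have "T \<subseteq> carrier G" using TT by auto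
  ultimately show ?thesis using that by blast
qed

text \<open>
  The hypothesis says that the \<open>U\<close>-conjugates of \<open>b\<close> run exactly once through the coset \<open>U b\<close>.
  Summing over a transversal of \<open>U\<close> rather than over \<open>L\<close> is essential: applying
  \<open>conj_sum_subgroup_translate\<close> to \<open>U b\<close> only puts the multiple \<open>|U|\<close> of \<open>conj_sum b\<close> into the ideal.
\<close>

lemma (in finite_normal) conj_sum_in_if_twist:
  assumes U: "subgroup U G" "U \<noteq> {\<one>}" and b: "b \<in> N"
    and bij: "bij_betw \<phi> U U" and twist: "\<And>u. u \<in> U \<Longrightarrow> conj_by u b = \<phi> u \<otimes> b"
  shows "conj_sum b \<in> scharlau_ideal G"
proof -
  have sub: "U \<subseteq> N" using subgroup.subset[OF U(1)] by simp
  have UL: "subgroup U L" using incl_subgroup[OF is_subgroup U(1)] .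
  obtain T where T: "T \<subseteq> carrier L" "bij_betw (\<lambda>(g, w). g \<otimes> w) (T \<times> U) (carrier L)"
    using transversal_exists[OF UL] .
  have "conj_sum b = (\<Sum>g\<in>T. \<Sum>u\<in>U. grp_elem (conj_by g (conj_by u b)))"
    using T sub b subset by (intro conj_sum_factor) auto
  also have "\<dots> = (\<Sum>g\<in>T. \<Sum>u\<in>U. grp_elem (conj_by g (\<phi> u \<otimes> b)))"
    by (simp add: twist)
  also have "\<dots> = (\<Sum>g\<in>T. \<Sum>u\<in>U. grp_elem (conj_by g (u \<otimes> b)))"
    by (simp add: sum.reindex_bij_betw[OF bij, of "\<lambda>u. grp_elem (conj_by g (u \<otimes> b))" for g])
  also have "\<dots> \<in> scharlau_ideal G"
    using T(1) U b by (intro group.scharlau_ideal_sum[OF group_G fin_G] conjugate_subgroup_translate) auto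
  finally show ?thesis .
qed

lemma (in group) add_pow_one:
  "[(n::nat)] \<cdot>\<^bsub>int_group_ring G\<^esub> \<one>\<^bsub>int_group_ring G\<^esub> = (\<Sum>i<n. grp_elem \<one>)"
  by (induction n) (auto simp: add_pow_def int_group_ring_simps nat_pow_def zero_fun_def plus_fun_def
      algebra_simps)

text \<open>
  The \<open>W\<close>-conjugates of \<open>b\<close> add up to the sum of \<open>U\<close> minus the identity. Conjugating this by all
  elements of \<open>N\<close> shows that \<open>conj_sum b\<close> is an element of the ideal minus \<open>|N|\<close>.
\<close>

lemma (in finite_normal) order_in_if_conj_sum_in:
  assumes U: "subgroup U G" "U \<noteq> {\<one>}" and b: "b \<in> N"
    and W: "W \<subseteq> carrier L" and L: "bij_betw (\<lambda>(g, w). g \<otimes> w) (N \<times> W) (carrier L)"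
    and bij: "bij_betw (\<lambda>w. conj_by w b) W (U - {\<one>})"
    and conj_sum: "conj_sum b \<in> scharlau_ideal G"
  shows "[order G] \<cdot>\<^bsub>int_group_ring G\<^esub> \<one>\<^bsub>int_group_ring G\<^esub> \<in> scharlau_ideal G"
proof -
  have sub: "U \<subseteq> N" using subgroup.subset[OF U(1)] by simp
  have finU: "finite U" using finite_subset[OF sub] fin_G by simp
  have one: "\<one> \<in> U" using subgroup.one_closed[OF U(1)] by simp
  have "conj_sum b = (\<Sum>g\<in>N. \<Sum>w\<in>W. grp_elem (conj_by g (conj_by w b)))"
    using L W b subset by (intro conj_sum_factor) auto
  also have "\<dots> = (\<Sum>g\<in>N. \<Sum>u\<in>U - {\<one>}. grp_elem (conj_by g u))"
    by (simp add: sum.reindex_bij_betw[OF bij, of "\<lambda>x. grp_elem (conj_by g x)" for g])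
  also have "\<dots> = (\<Sum>g\<in>N. (\<Sum>u\<in>U. grp_elem (conj_by g (u \<otimes> \<one>))) - grp_elem \<one>)"
  proof (intro sum.cong refl)
    fix g assume "g \<in> N"
    moreover have "(\<Sum>u\<in>U. grp_elem (conj_by g (u \<otimes> \<one>))) = (\<Sum>u\<in>U. grp_elem (conj_by g u))"
      using sub subset by (intro sum.cong refl) auto
    ultimately show "(\<Sum>u\<in>U - {\<one>}. grp_elem (conj_by g u)) =
      (\<Sum>u\<in>U. grp_elem (conj_by g (u \<otimes> \<one>))) - grp_elem \<one>"
      using sum.remove[OF finU one, of "\<lambda>u. grp_elem (conj_by g u)"] by simp
  qed
  also have "\<dots> = (\<Sum>g\<in>N. \<Sum>u\<in>U. grp_elem (conj_by g (u \<otimes> \<one>))) - (\<Sum>g\<in>N. grp_elem \<one>)"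
    by (rule sum_subtractf)
  finally have "(\<Sum>g\<in>N. grp_elem \<one>) = (\<Sum>g\<in>N. \<Sum>u\<in>U. grp_elem (conj_by g (u \<otimes> \<one>))) - conj_sum b"
    by simp
  moreover have "(\<Sum>g\<in>N. \<Sum>u\<in>U. grp_elem (conj_by g (u \<otimes> \<one>))) \<in> scharlau_ideal G"
    using U by (intro group.scharlau_ideal_sum[OF group_G fin_G] conjugate_subgroup_translate) auto
  ultimately have "(\<Sum>g\<in>N. grp_elem \<one>) \<in> scharlau_ideal G"
    using conj_sum group.scharlau_ideal_diff[OF group_G fin_G] by simp
  moreover have "(\<Sum>g\<in>N. grp_elem \<one>) = [order G] \<cdot>\<^bsub>int_group_ring G\<^esub> \<one>\<^bsub>int_group_ring G\<^esub>"
    using group.add_pow_one[OF group_G] by (simp add: order_def)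
  ultimately show ?thesis by simp
qed

lemma (in group) subgroup_order2:
  assumes "z \<in> carrier G" "z \<otimes> z = \<one>"
  shows "subgroup {\<one>, z} G"
  using assms inv_equality[of z z] by unfold_locales auto

lemma (in group) subgroup_order3:
  assumes x: "x \<in> carrier G" "x \<otimes> x \<otimes> x = \<one>"
  shows "subgroup {\<one>, x, x \<otimes> x} G"
proof -
  have x': "x \<otimes> (x \<otimes> x) = \<one>" using x by (simp add: m_assoc)
  have inv: "inv x = x \<otimes> x" "inv (x \<otimes> x) = x"
    using inv_equality[of "x \<otimes> x" x] inv_equality[of x "x \<otimes> x"] x x' by auto
  have "x \<otimes> x \<otimes> (x \<otimes> x) = x"
    using x x' by (simp add: m_assoc)
  then show ?thesis
    using x x' inv by unfold_locales auto
qed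

context finite_normal
begin

lemma conj_sum_order2:
  assumes z: "z \<in> N" "z \<noteq> \<one>" "z \<otimes> z = \<one>" and b: "b \<in> N"
  shows "conj_sum b + conj_sum (z \<otimes> b) \<in> scharlau_ideal G"
proof -
  have "subgroup {\<one>, z} G"
    using group.subgroup_order2[OF group_G, of z] z by simp
  then have "(\<Sum>h\<in>{\<one>, z}. conj_sum (h \<otimes> b)) \<in> scharlau_ideal G"
    using z b by (intro conj_sum_subgroup_translate) auto
  then show ?thesis using z b subset by (simp add: subset_iff)
qed

lemma conj_sum_order3:
  assumes x: "x \<in> N" "x \<noteq> \<one>" "x \<otimes> x \<otimes> x = \<one>" and b: "b \<in> N"
  shows "conj_sum b + conj_sum (x \<otimes> b) + conj_sum (x \<otimes> x \<otimes> b) \<in> scharlau_ideal G"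
proof -
  have "subgroup {\<one>, x, x \<otimes> x} G"
    using group.subgroup_order3[OF group_G, of x] x by simp
  then have "(\<Sum>h\<in>{\<one>, x, x \<otimes> x}. conj_sum (h \<otimes> b)) \<in> scharlau_ideal G"
    using x b by (intro conj_sum_subgroup_translate) auto
  moreover have "x \<otimes> x \<noteq> \<one>" "x \<otimes> x \<noteq> x"
    using x subset by (auto simp: subset_iff)
  ultimately show ?thesis using x b subset by (simp add: subset_iff add.assoc)
qed

lemma conj_by_eqI:
  assumes "g \<in> carrier L" "b \<in> carrier L" "c \<in> carrier L" "g \<otimes> b = c \<otimes> g"
  shows "conj_by g b = c"
  using assms by (simp add: conj_by_def m_assoc)

end

section \<open>The general linear group of degree two\<close>

definition GL2 :: "('a, 'm) ring_scheme \<Rightarrow> ('a \<times> 'a \<times> 'a \<times> 'a) monoid" where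
  "GL2 R = (SL2 R)\<lparr>carrier := {(a, b, c, d). a \<in> carrier R \<and> b \<in> carrier R \<and> c \<in> carrier R \<and>
     d \<in> carrier R \<and> a \<otimes>\<^bsub>R\<^esub> d \<ominus>\<^bsub>R\<^esub> b \<otimes>\<^bsub>R\<^esub> c \<noteq> \<zero>\<^bsub>R\<^esub>}\<rparr>"

lemma GL2_simps [simp]:
  "(a, b, c, d) \<otimes>\<^bsub>GL2 R\<^esub> (a', b', c', d') =
    (a \<otimes>\<^bsub>R\<^esub> a' \<oplus>\<^bsub>R\<^esub> b \<otimes>\<^bsub>R\<^esub> c', a \<otimes>\<^bsub>R\<^esub> b' \<oplus>\<^bsub>R\<^esub> b \<otimes>\<^bsub>R\<^esub> d',
     c \<otimes>\<^bsub>R\<^esub> a' \<oplus>\<^bsub>R\<^esub> d \<otimes>\<^bsub>R\<^esub> c', c \<otimes>\<^bsub>R\<^esub> b' \<oplus>\<^bsub>R\<^esub> d \<otimes>\<^bsub>R\<^esub> d')"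
  "\<one>\<^bsub>GL2 R\<^esub> = (\<one>\<^bsub>R\<^esub>, \<zero>\<^bsub>R\<^esub>, \<zero>\<^bsub>R\<^esub>, \<one>\<^bsub>R\<^esub>)"
  "(a, b, c, d) \<in> carrier (GL2 R) \<longleftrightarrow> a \<in> carrier R \<and> b \<in> carrier R \<and> c \<in> carrier R \<and>
     d \<in> carrier R \<and> a \<otimes>\<^bsub>R\<^esub> d \<ominus>\<^bsub>R\<^esub> b \<otimes>\<^bsub>R\<^esub> c \<noteq> \<zero>\<^bsub>R\<^esub>"
  "(a, b, c, d) \<in> carrier (SL2 R) \<longleftrightarrow> a \<in> carrier R \<and> b \<in> carrier R \<and> c \<in> carrier R \<and>
     d \<in> carrier R \<and> a \<otimes>\<^bsub>R\<^esub> d \<ominus>\<^bsub>R\<^esub> b \<otimes>\<^bsub>R\<^esub> c = \<one>\<^bsub>R\<^esub>"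
  by (simp_all add: GL2_def SL2_def)

lemma SL2_eq_GL2: "SL2 R = (GL2 R)\<lparr>carrier := carrier (SL2 R)\<rparr>"
  by (simp add: GL2_def)

context field
begin

definition det2 :: "'a \<times> 'a \<times> 'a \<times> 'a \<Rightarrow> 'a" where
  "det2 = (\<lambda>(a, b, c, d). a \<otimes> d \<ominus> b \<otimes> c)"

lemma det2_mult:
  assumes "a \<in> carrier R" "b \<in> carrier R" "c \<in> carrier R" "d \<in> carrier R"
    "a' \<in> carrier R" "b' \<in> carrier R" "c' \<in> carrier R" "d' \<in> carrier R"
  shows "(a \<otimes> a' \<oplus> b \<otimes> c') \<otimes> (c \<otimes> b' \<oplus> d \<otimes> d') \<ominus> (a \<otimes> b' \<oplus> b \<otimes> d') \<otimes> (c \<otimes> a' \<oplus> d \<otimes> c') =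
    (a \<otimes> d \<ominus> b \<otimes> c) \<otimes> (a' \<otimes> d' \<ominus> b' \<otimes> c')"
  using assms by algebra

lemma GL2_group: "group (GL2 R)"
proof (rule groupI)
  fix x y assume "x \<in> carrier (GL2 R)" "y \<in> carrier (GL2 R)"
  then show "x \<otimes>\<^bsub>GL2 R\<^esub> y \<in> carrier (GL2 R)"
    by (cases x, cases y) (simp add: det2_mult integral_iff)
next
  show "\<one>\<^bsub>GL2 R\<^esub> \<in> carrier (GL2 R)"
    by (simp add: minus_eq)
next
  fix x y z
  assume "x \<in> carrier (GL2 R)" "y \<in> carrier (GL2 R)" "z \<in> carrier (GL2 R)"
  then show "x \<otimes>\<^bsub>GL2 R\<^esub> y \<otimes>\<^bsub>GL2 R\<^esub> z = x \<otimes>\<^bsub>GL2 R\<^esub> (y \<otimes>\<^bsub>GL2 R\<^esub> z)"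
    by (cases x, cases y, cases z) (simp add: l_distr r_distr m_assoc a_ac)
next
  fix x assume "x \<in> carrier (GL2 R)"
  then show "\<one>\<^bsub>GL2 R\<^esub> \<otimes>\<^bsub>GL2 R\<^esub> x = x"
    by (cases x) simp
next
  fix x assume x: "x \<in> carrier (GL2 R)"
  obtain a b c d where xe: "x = (a, b, c, d)" by (cases x)
  with x have car [simp]: "a \<in> carrier R" "b \<in> carrier R" "c \<in> carrier R" "d \<in> carrier R"
    and det: "a \<otimes> d \<ominus> b \<otimes> c \<noteq> \<zero>" by auto
  define e where "e = inv (a \<otimes> d \<ominus> b \<otimes> c)"
  have e [simp]: "e \<in> carrier R" and e1: "e \<otimes> (a \<otimes> d \<ominus> b \<otimes> c) = \<one>"
    using det field_Units by (auto simp: e_def)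
  have e0: "e \<noteq> \<zero>" using e1 by auto
  have "(e \<otimes> d) \<otimes> (e \<otimes> a) \<ominus> (e \<otimes> \<ominus> b) \<otimes> (e \<otimes> \<ominus> c) = e \<otimes> (e \<otimes> (a \<otimes> d \<ominus> b \<otimes> c))"
    using car e by algebra
  moreover have "e \<otimes> d \<otimes> a \<oplus> e \<otimes> \<ominus> b \<otimes> c = e \<otimes> (a \<otimes> d \<ominus> b \<otimes> c)"
    "e \<otimes> d \<otimes> b \<oplus> e \<otimes> \<ominus> b \<otimes> d = \<zero>" "e \<otimes> \<ominus> c \<otimes> a \<oplus> e \<otimes> a \<otimes> c = \<zero>"
    "e \<otimes> \<ominus> c \<otimes> b \<oplus> e \<otimes> a \<otimes> d = e \<otimes> (a \<otimes> d \<ominus> b \<otimes> c)"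
    using car e by algebra+
  ultimately show "\<exists>y \<in> carrier (GL2 R). y \<otimes>\<^bsub>GL2 R\<^esub> x = \<one>\<^bsub>GL2 R\<^esub>"
    using e0 by (intro bexI[of _ "(e \<otimes> d, e \<otimes> \<ominus> b, e \<otimes> \<ominus> c, e \<otimes> a)"]) (simp_all add: xe e1)
qed

lemma SL2_normal: "carrier (SL2 R) \<lhd> GL2 R"
proof -
  \<comment> \<open>It is the kernel of the determinant.\<close>
  have "group_hom (GL2 R) (mult_of R) det2"
    by (intro group_hom.intro GL2_group field_mult_group group_hom_axioms.intro homI)
      (auto simp: det2_def det2_mult)
  then have "kernel (GL2 R) (mult_of R) det2 \<lhd> GL2 R"
    by (rule group_hom.normal_kernel)
  also have "kernel (GL2 R) (mult_of R) det2 = carrier (SL2 R)"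
    by (auto simp: kernel_def det2_def)
  finally show ?thesis .
qed

end

locale finite_field = field R for R (structure) +
  assumes finR: "finite (carrier R)"
begin

lemma finite_GL2: "finite (carrier (GL2 R))"
  by (rule finite_subset[of _ "carrier R \<times> carrier R \<times> carrier R \<times> carrier R"])
    (auto simp: finR)

sublocale gl: finite_normal "carrier (SL2 R)" "GL2 R"
  by (intro finite_normal.intro SL2_normal finite_normal_axioms.intro finite_GL2)

abbreviation \<J> where "\<J> \<equiv> scharlau_ideal (SL2 R)"

lemma G_eq: "(GL2 R)\<lparr>carrier := carrier (SL2 R)\<rparr> = SL2 R"
  by (rule SL2_eq_GL2[symmetric])

lemma order_SL2: "order (SL2 R) = (card (carrier R) - 1) * card (carrier R) * (card (carrier R) + 1)"
proof -
  let ?K = "carrier R" and ?q = "card (carrier R)"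
  \<comment> \<open>If the upper left entry is non-zero, it determines the lower right entry together with the
    other two; if it is zero, the two entries off the diagonal determine each other.\<close>
  let ?A = "(\<lambda>(a, b, c). (a, b, c, inv a \<otimes> (\<one> \<oplus> b \<otimes> c))) ` ((?K - {\<zero>}) \<times> ?K \<times> ?K)"
  let ?B = "(\<lambda>(b, d). (\<zero>, b, \<ominus> (inv b), d)) ` ((?K - {\<zero>}) \<times> ?K)"
  have inv: "inv a \<in> carrier R" "a \<otimes> inv a = \<one>" "inv a \<otimes> a = \<one>" if "a \<in> carrier R" "a \<noteq> \<zero>" for a
    using that field_Units by auto
  have d: "d = inv a \<otimes> (\<one> \<oplus> b \<otimes> c)"
    if "a \<in> ?K" "b \<in> ?K" "c \<in> ?K" "d \<in> ?K" "a \<otimes> d \<ominus> b \<otimes> c = \<one>" "a \<noteq> \<zero>" for a b c d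
  proof -
    have "(a \<otimes> d \<ominus> b \<otimes> c) \<oplus> b \<otimes> c = a \<otimes> d"
      using that(1-4) by algebra
    then have "inv a \<otimes> (\<one> \<oplus> b \<otimes> c) = inv a \<otimes> a \<otimes> d"
      using that inv[of a] by (simp add: m_assoc[symmetric])
    then show ?thesis using that inv by simp
  qed
  have c: "c = \<ominus> (inv b)" "b \<noteq> \<zero>"
    if "b \<in> ?K" "c \<in> ?K" "d \<in> ?K" "\<zero> \<otimes> d \<ominus> b \<otimes> c = \<one>" for b c d
  proof -
    show b: "b \<noteq> \<zero>" using that by (auto simp: minus_eq)
    have "\<ominus> (b \<otimes> c) = \<one>" using that by (simp add: minus_eq)
    then have "b \<otimes> c = \<ominus> \<one>" using that by (metis m_closed minus_minus)
    then have "inv b \<otimes> b \<otimes> c = inv b \<otimes> \<ominus> \<one>"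
      using that inv(1)[OF _ b] by (simp add: m_assoc)
    then show "c = \<ominus> (inv b)" using that inv[OF _ b] by (simp add: r_minus)
  qed
  have A: "a \<otimes> (inv a \<otimes> (\<one> \<oplus> b \<otimes> c)) \<ominus> b \<otimes> c = \<one>"
    if "a \<in> ?K" "b \<in> ?K" "c \<in> ?K" "a \<noteq> \<zero>" for a b c
  proof -
    have "a \<otimes> (inv a \<otimes> (\<one> \<oplus> b \<otimes> c)) = \<one> \<oplus> b \<otimes> c"
      using that inv[of a] by (simp add: m_assoc[symmetric])
    then have "a \<otimes> (inv a \<otimes> (\<one> \<oplus> b \<otimes> c)) \<ominus> b \<otimes> c = (\<one> \<oplus> b \<otimes> c) \<ominus> b \<otimes> c" by simp
    also have "\<dots> = \<one>"
      using that by algebra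
    finally show ?thesis .
  qed
  have B: "\<zero> \<otimes> d \<ominus> b \<otimes> (\<ominus> (inv b)) = \<one>" if "b \<in> ?K" "d \<in> ?K" "b \<noteq> \<zero>" for b d
    using that inv[of b] by (simp add: minus_eq r_minus)
  have "carrier (SL2 R) = ?A \<union> ?B"
  proof
    show "carrier (SL2 R) \<subseteq> ?A \<union> ?B"
    proof
      fix x assume x: "x \<in> carrier (SL2 R)"
      obtain a b c' d' where xe: "x = (a, b, c', d')" by (cases x)
      show "x \<in> ?A \<union> ?B"
      proof (cases "a = \<zero>")
        case True
        then show ?thesis using x c[of b c' d'] by (auto simp: xe image_iff)
      next
        case False
        then show ?thesis using x d[of a b c' d'] by (auto simp: xe image_iff)
      qed
    qed
    have A': "(a, b, c, inv a \<otimes> (\<one> \<oplus> b \<otimes> c)) \<in> carrier (SL2 R)"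
      if "a \<in> ?K" "b \<in> ?K" "c \<in> ?K" "a \<noteq> \<zero>" for a b c
      using that A inv(1) by simp
    have B': "(\<zero>, b, \<ominus> (inv b), d) \<in> carrier (SL2 R)"
      if "b \<in> ?K" "d \<in> ?K" "b \<noteq> \<zero>" for b d
      using that B inv(1) by simp
    show "?A \<union> ?B \<subseteq> carrier (SL2 R)"
    proof (intro Un_least subsetI)
      fix x assume "x \<in> ?A"
      then obtain a b c where "a \<in> ?K" "b \<in> ?K" "c \<in> ?K" "a \<noteq> \<zero>"
        "x = (a, b, c, inv a \<otimes> (\<one> \<oplus> b \<otimes> c))" by auto
      then show "x \<in> carrier (SL2 R)" by (simp add: A' del: GL2_simps)
    next
      fix x assume "x \<in> ?B"
      then obtain b d where "b \<in> ?K" "d \<in> ?K" "b \<noteq> \<zero>" "x = (\<zero>, b, \<ominus> (inv b), d)" by auto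
      then show "x \<in> carrier (SL2 R)" by (simp add: B' del: GL2_simps)
    qed
  qed
  moreover have "card ?A = (?q - 1) * (?q * ?q)"
    using finR by (subst card_image) (auto simp: inj_on_def card_cartesian_product card_Diff_singleton)
  moreover have "card ?B = (?q - 1) * ?q"
    using finR by (subst card_image) (auto simp: inj_on_def card_cartesian_product card_Diff_singleton)
  moreover have "?A \<inter> ?B = {}" by auto
  moreover have "finite ?A" "finite ?B" using finR by auto
  ultimately have "order (SL2 R) = (?q - 1) * (?q * ?q) + (?q - 1) * ?q"
    unfolding order_def by (simp add: card_Un_disjoint)
  then show ?thesis by (simp add: algebra_simps)
qed

section \<open>Conjugation sums depend only on the trace\<close>

text \<open>The matrix is the companion matrix of \<open>X\<^sup>2 - s X + 1\<close>.\<close>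

definition trace_sum :: "'a \<Rightarrow> ('a \<times> 'a \<times> 'a \<times> 'a) \<Rightarrow> int" where
  "trace_sum s = gl.conj_sum (\<zero>, \<ominus> \<one>, \<one>, s)"

lemma companion_SL2: "s \<in> carrier R \<Longrightarrow> (\<zero>, \<ominus> \<one>, \<one>, s) \<in> carrier (SL2 R)"
  by (simp add: minus_eq)

lemma SL2_GL2: "x \<in> carrier (SL2 R) \<Longrightarrow> x \<in> carrier (GL2 R)"
  by (cases x) auto

text \<open>
  The first unit vector \<open>v\<close> is cyclic for a matrix \<open>x\<close> whose lower left entry is non-zero, and in
  the basis \<open>v\<close>, \<open>x v\<close> the matrix becomes the companion matrix. The matrix that is conjugated with
  has \<open>v\<close> and \<open>x v\<close> as its columns; its determinant \<open>c\<close> may be a non-square, which is why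
  conjugation by \<open>SL2\<close> would not suffice.
\<close>

lemma conj_sum_eq_trace_sum:
  assumes x: "(a, b, c, d) \<in> carrier (SL2 R)" and c0: "c \<noteq> \<zero>" and s: "s = a \<oplus> d"
  shows "gl.conj_sum (a, b, c, d) = trace_sum s"
proof -
  have car [simp]: "a \<in> carrier R" "b \<in> carrier R" "c \<in> carrier R" "d \<in> carrier R"
    and det: "a \<otimes> d \<ominus> b \<otimes> c = \<one>"
    using x by auto
  have "b \<otimes> c = a \<otimes> d \<ominus> (a \<otimes> d \<ominus> b \<otimes> c)" using car by algebra
  then have bc: "b \<otimes> c = a \<otimes> d \<ominus> \<one>" by (simp add: det)
  have h: "(\<one>, a, \<zero>, c) \<in> carrier (GL2 R)"
    using c0 by (simp add: minus_eq)
  have e: "\<one> \<otimes> \<zero> \<oplus> a \<otimes> \<one> = a \<otimes> \<one> \<oplus> b \<otimes> \<zero>"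
    "\<one> \<otimes> \<ominus> \<one> \<oplus> a \<otimes> (a \<oplus> d) = a \<otimes> a \<oplus> (a \<otimes> d \<ominus> \<one>)"
    "\<zero> \<otimes> \<zero> \<oplus> c \<otimes> \<one> = c \<otimes> \<one> \<oplus> d \<otimes> \<zero>"
    "\<zero> \<otimes> \<ominus> \<one> \<oplus> c \<otimes> (a \<oplus> d) = c \<otimes> a \<oplus> d \<otimes> c"
    using car by algebra+
  have "gl.conj_by (\<one>, a, \<zero>, c) (\<zero>, \<ominus> \<one>, \<one>, s) = (a, b, c, d)"
    using e by (intro gl.conj_by_eqI h SL2_GL2 x companion_SL2) (simp_all add: s bc)
  then show ?thesis
    using gl.conj_sum_conj_by[OF h SL2_GL2[OF companion_SL2, of s]] by (simp add: trace_sum_def s)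
qed

section \<open>Relations between the trace sums\<close>

lemma trace_sum_uminus:
  assumes two: "\<one> \<oplus> \<one> \<noteq> \<zero>" and s [simp]: "s \<in> carrier R"
  shows "trace_sum s + trace_sum (\<ominus> s) \<in> \<J>"
proof -
  let ?z = "(\<ominus> \<one>, \<zero>, \<zero>, \<ominus> \<one>)"
  have one: "\<ominus> \<one> \<noteq> \<one>"
  proof
    assume "\<ominus> \<one> = \<one>"
    then have "\<one> \<oplus> \<one> = \<one> \<oplus> \<ominus> \<one>" by simp
    then show False using two by (simp add: r_neg)
  qed
  have neg0: "\<ominus> \<one> \<noteq> \<zero>"
    by (metis add.inv_eq_1_iff one_closed zero_not_one)
  have zz: "\<ominus> \<one> \<otimes> \<ominus> \<one> \<ominus> \<zero> \<otimes> \<zero> = \<one>" "\<ominus> \<one> \<otimes> \<ominus> \<one> \<oplus> \<zero> \<otimes> \<zero> = \<one>"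
    "\<ominus> \<one> \<otimes> \<zero> \<oplus> \<zero> \<otimes> \<ominus> \<one> = \<zero>" "\<zero> \<otimes> \<ominus> \<one> \<oplus> \<ominus> \<one> \<otimes> \<zero> = \<zero>" "\<zero> \<otimes> \<zero> \<oplus> \<ominus> \<one> \<otimes> \<ominus> \<one> = \<one>"
    using s by algebra+
  have "gl.conj_sum (\<zero>, \<ominus> \<one>, \<one>, s) + gl.conj_sum (?z \<otimes>\<^bsub>GL2 R\<^esub> (\<zero>, \<ominus> \<one>, \<one>, s))
      \<in> scharlau_ideal gl.G"
    using one zz by (intro gl.conj_sum_order2 companion_SL2) simp_all
  moreover have "?z \<otimes>\<^bsub>GL2 R\<^esub> (\<zero>, \<ominus> \<one>, \<one>, s) = (\<zero>, \<one>, \<ominus> \<one>, \<ominus> s)"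
  proof -
    have "\<ominus> \<one> \<otimes> \<zero> \<oplus> \<zero> \<otimes> \<one> = \<zero>" "\<ominus> \<one> \<otimes> \<ominus> \<one> \<oplus> \<zero> \<otimes> s = \<one>"
      "\<zero> \<otimes> \<zero> \<oplus> \<ominus> \<one> \<otimes> \<one> = \<ominus> \<one>" "\<zero> \<otimes> \<ominus> \<one> \<oplus> \<ominus> \<one> \<otimes> s = \<ominus> s"
      using s by algebra+
    then show ?thesis by simp
  qed
  moreover have "gl.conj_sum (\<zero>, \<one>, \<ominus> \<one>, \<ominus> s) = trace_sum (\<ominus> s)"
    using neg0 by (intro conj_sum_eq_trace_sum) (simp_all add: minus_eq)
  ultimately show ?thesis by (simp add: G_eq trace_sum_def)
qed

text \<open>
  Lower rather than upper triangular matrices are used, so that the non-trivial ones have a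
  non-zero lower left entry, as \<open>conj_sum_eq_trace_sum\<close> demands.
\<close>

definition U where "U = (\<lambda>u. (\<one>, \<zero>, u, \<one>)) ` carrier R"

lemma unipotent_mult: "u \<in> carrier R \<Longrightarrow> v \<in> carrier R \<Longrightarrow>
   (\<one>, \<zero>, u, \<one>) \<otimes>\<^bsub>GL2 R\<^esub> (\<one>, \<zero>, v, \<one>) = (\<one>, \<zero>, u \<oplus> v, \<one>)"
  by simp

lemma unipotent_SL2: "u \<in> carrier R \<Longrightarrow> (\<one>, \<zero>, u, \<one>) \<in> carrier (SL2 R)"
  by (simp add: minus_eq)

lemma subgroup_U: "subgroup U gl.G"
proof (rule group.subgroupI[OF gl.group_G])
  show "U \<subseteq> carrier gl.G" using unipotent_SL2 by (auto simp: U_def)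
  show "U \<noteq> {}" by (auto simp: U_def)
  fix x assume "x \<in> U"
  then obtain u where u: "u \<in> carrier R" "x = (\<one>, \<zero>, u, \<one>)" by (auto simp: U_def)
  have "inv\<^bsub>gl.G\<^esub> x = (\<one>, \<zero>, \<ominus> u, \<one>)"
    using u unipotent_SL2 unipotent_mult[of "\<ominus> u" u] by (intro group.inv_equality[OF gl.group_G]) (auto simp: l_neg)
  then show "inv\<^bsub>gl.G\<^esub> x \<in> U" using u by (auto simp: U_def)
  fix y assume "y \<in> U"
  then show "x \<otimes>\<^bsub>gl.G\<^esub> y \<in> U" using u unipotent_mult by (auto simp: U_def)
qed

lemma U_nontrivial: "U \<noteq> {\<one>\<^bsub>GL2 R\<^esub>}"
proof -
  have "(\<one>, \<zero>, \<one>, \<one>) \<in> U" by (auto simp: U_def)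
  then show ?thesis by auto
qed

text \<open>
  For \<open>u\<close> in \<open>U\<close> with entry \<open>c\<close>, the conjugate \<open>u b u\<inverse>\<close> of \<open>b = diag (e, f)\<close> is \<open>u' b\<close>, where \<open>u'\<close>
  has the entry \<open>c (1 - f / e)\<close>. As \<open>e \<noteq> f\<close>, this is a permutation of \<open>U\<close>.
\<close>

lemma trace_sum_split:
  assumes car [simp]: "e \<in> carrier R" "f \<in> carrier R" and ef: "e \<otimes> f = \<one>" and ne: "e \<noteq> f"
  shows "gl.conj_sum (e, \<zero>, \<zero>, f) \<in> \<J>" "trace_sum (e \<oplus> f) \<in> \<J>"
proof -
  let ?b = "(e, \<zero>, \<zero>, f)"
  have fe: "f \<otimes> e = \<one>" using ef by (simp add: m_comm)
  have b: "?b \<in> carrier (SL2 R)" using ef by (simp add: minus_eq)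
  \<comment> \<open>This is the factor \<open>1 - f / e\<close>, because \<open>f\<close> is the inverse of \<open>e\<close>.\<close>
  define D where "D = f \<otimes> (e \<ominus> f)"
  have D [simp]: "D \<in> carrier R" by (simp add: D_def)
  have f0: "f \<noteq> \<zero>" "e \<noteq> \<zero>" using ef by auto
  have D0: "D \<noteq> \<zero>" using f0 ne by (simp add: D_def integral_iff)
  have De: "D \<otimes> e = e \<ominus> f"
  proof -
    have "D \<otimes> e = (f \<otimes> e) \<otimes> (e \<ominus> f)" unfolding D_def using car by algebra
    then show ?thesis by (simp add: fe)
  qed
  have twist: "gl.conj_by (\<one>, \<zero>, u, \<one>) ?b = (\<one>, \<zero>, u \<otimes> D, \<one>) \<otimes>\<^bsub>GL2 R\<^esub> ?b" if u [simp]: "u \<in> carrier R" for u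
  proof (rule gl.conj_by_eqI)
    show "(\<one>, \<zero>, u, \<one>) \<in> carrier (GL2 R)" "?b \<in> carrier (GL2 R)"
      using unipotent_SL2 b SL2_GL2 by simp_all
    show "(\<one>, \<zero>, u \<otimes> D, \<one>) \<otimes>\<^bsub>GL2 R\<^esub> ?b \<in> carrier (GL2 R)"
      using unipotent_SL2 b SL2_GL2 by (intro gl.m_closed) simp_all
    have "u \<otimes> D \<otimes> e = u \<otimes> (e \<ominus> f)" by (simp add: m_assoc De)
    moreover have "u \<otimes> (e \<ominus> f) \<oplus> f \<otimes> u = u \<otimes> e" using car u by algebra
    ultimately show "(\<one>, \<zero>, u, \<one>) \<otimes>\<^bsub>GL2 R\<^esub> ?b = (\<one>, \<zero>, u \<otimes> D, \<one>) \<otimes>\<^bsub>GL2 R\<^esub> ?b \<otimes>\<^bsub>GL2 R\<^esub> (\<one>, \<zero>, u, \<one>)"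
      by simp
  qed
  let ?\<phi> = "\<lambda>(a, b, c, d). (a, b, c \<otimes> D, d)"
  have "inj_on ?\<phi> U"
    using D0 by (auto simp: inj_on_def U_def m_rcancel)
  moreover have "?\<phi> ` U \<subseteq> U" by (auto simp: U_def)
  moreover have "finite U" using finR by (simp add: U_def)
  ultimately have "bij_betw ?\<phi> U U"
    by (simp add: bij_betw_def endo_inj_surj)
  then have "gl.conj_sum ?b \<in> scharlau_ideal gl.G"
    by (rule gl.conj_sum_in_if_twist[OF subgroup_U U_nontrivial b]) (auto simp: U_def twist)
  then show *: "gl.conj_sum ?b \<in> \<J>" by (simp add: G_eq)
  have "gl.conj_by (\<one>, \<zero>, \<one>, \<one>) ?b = (e, \<zero>, e \<ominus> f, f)"
    using twist[of \<one>] by (simp add: De)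
  then have "gl.conj_sum (e, \<zero>, e \<ominus> f, f) = gl.conj_sum ?b"
    using gl.conj_sum_conj_by[OF SL2_GL2[OF unipotent_SL2[of \<one>]] SL2_GL2[OF b]] by simp
  moreover have "gl.conj_sum (e, \<zero>, e \<ominus> f, f) = trace_sum (e \<oplus> f)"
    using ef ne by (intro conj_sum_eq_trace_sum) (simp_all add: minus_eq[of \<one>])
  ultimately show "trace_sum (e \<oplus> f) \<in> \<J>" using * by simp
qed

text \<open>
  The subgroup used here has order three. Its generator \<open>x\<close> has trace \<open>- 1\<close> and upper left entry
  \<open>a\<close>, chosen so that \<open>x diag (e, f)\<close> has trace \<open>s\<close>. With \<open>1\<close> as lower left entry of \<open>x\<close>,
  the products of \<open>x\<close> and of \<open>x\<^sup>2 = - 1 - x\<close> with \<open>diag (e, f)\<close> have the non-zero lower left entries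
  \<open>e\<close> and \<open>- e\<close>, whatever \<open>s\<close> is.
\<close>

lemma trace_sum_shift:
  assumes two: "\<one> \<oplus> \<one> \<noteq> \<zero>"
    and car [simp]: "e \<in> carrier R" "f \<in> carrier R" and ef: "e \<otimes> f = \<one>" and ne: "e \<noteq> f"
    and s [simp]: "s \<in> carrier R" and ks: "trace_sum s \<in> \<J>"
  shows "trace_sum (s \<oplus> (e \<oplus> f)) \<in> \<J>"
proof -
  let ?b = "(e, \<zero>, \<zero>, f)"
  have b: "?b \<in> carrier (SL2 R)" using ef by (simp add: minus_eq)
  have ef0: "e \<ominus> f \<noteq> \<zero>" using ne by simp
  have e0: "e \<noteq> \<zero>" using ef by auto
  then have e0': "\<ominus> e \<noteq> \<zero>" by simp
  define i where "i = inv (e \<ominus> f)"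
  have i [simp]: "i \<in> carrier R" and ii: "i \<otimes> (e \<ominus> f) = \<one>"
    using ef0 field_Units by (auto simp: i_def)
  \<comment> \<open>The solution of \<open>a e - (1 + a) f = s\<close>.\<close>
  define a where "a = (s \<oplus> f) \<otimes> i"
  have a [simp]: "a \<in> carrier R" by (simp add: a_def)
  have "a \<otimes> (e \<ominus> f) = (s \<oplus> f) \<otimes> (i \<otimes> (e \<ominus> f))" unfolding a_def using car s i by algebra
  then have ae: "a \<otimes> (e \<ominus> f) = s \<oplus> f" by (simp add: ii)
  let ?\<beta> = "\<ominus> (a \<otimes> a \<oplus> a \<oplus> \<one>)"
  let ?x = "(a, ?\<beta>, \<one>, \<ominus> \<one> \<ominus> a)" and ?y = "(\<ominus> \<one> \<ominus> a, \<ominus> ?\<beta>, \<ominus> \<one>, a)"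
  have x: "?x \<in> carrier (SL2 R)"
  proof -
    have "a \<otimes> (\<ominus> \<one> \<ominus> a) \<ominus> ?\<beta> \<otimes> \<one> = \<one>" using car s a by algebra
    then show ?thesis by simp
  qed
  have xx: "?x \<otimes>\<^bsub>GL2 R\<^esub> ?x = ?y"
  proof -
    have "a \<otimes> a \<oplus> ?\<beta> \<otimes> \<one> = \<ominus> \<one> \<ominus> a" "a \<otimes> ?\<beta> \<oplus> ?\<beta> \<otimes> (\<ominus> \<one> \<ominus> a) = \<ominus> ?\<beta>"
      "\<one> \<otimes> a \<oplus> (\<ominus> \<one> \<ominus> a) \<otimes> \<one> = \<ominus> \<one>" "\<one> \<otimes> ?\<beta> \<oplus> (\<ominus> \<one> \<ominus> a) \<otimes> (\<ominus> \<one> \<ominus> a) = a"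
      using a by algebra+
    then show ?thesis by (simp only: GL2_simps)
  qed
  have yx: "?y \<otimes>\<^bsub>GL2 R\<^esub> ?x = \<one>\<^bsub>GL2 R\<^esub>"
  proof -
    have "(\<ominus> \<one> \<ominus> a) \<otimes> a \<oplus> \<ominus> ?\<beta> \<otimes> \<one> = \<one>" "(\<ominus> \<one> \<ominus> a) \<otimes> ?\<beta> \<oplus> \<ominus> ?\<beta> \<otimes> (\<ominus> \<one> \<ominus> a) = \<zero>"
      "\<ominus> \<one> \<otimes> a \<oplus> a \<otimes> \<one> = \<zero>" "\<ominus> \<one> \<otimes> ?\<beta> \<oplus> a \<otimes> (\<ominus> \<one> \<ominus> a) = \<one>"
      using a by algebra+
    then show ?thesis by (simp only: GL2_simps)
  qed
  have y: "?y \<in> carrier (SL2 R)"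
    using gl.subgroup_axioms x xx by (metis subgroup.m_closed)
  have xb: "?x \<otimes>\<^bsub>GL2 R\<^esub> ?b = (a \<otimes> e, ?\<beta> \<otimes> f, e, (\<ominus> \<one> \<ominus> a) \<otimes> f)"
    by simp
  have yb: "?y \<otimes>\<^bsub>GL2 R\<^esub> ?b = ((\<ominus> \<one> \<ominus> a) \<otimes> e, \<ominus> ?\<beta> \<otimes> f, \<ominus> e, a \<otimes> f)"
    by (simp add: l_minus)
  have "gl.conj_sum (?x \<otimes>\<^bsub>GL2 R\<^esub> ?b) = trace_sum s"
  proof -
    have "(a \<otimes> e, ?\<beta> \<otimes> f, e, (\<ominus> \<one> \<ominus> a) \<otimes> f) \<in> carrier (SL2 R)"
      using gl.subgroup_axioms x b xb by (metis subgroup.m_closed)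
    moreover have "s = a \<otimes> e \<oplus> (\<ominus> \<one> \<ominus> a) \<otimes> f"
    proof -
      have "a \<otimes> e \<oplus> (\<ominus> \<one> \<ominus> a) \<otimes> f = a \<otimes> (e \<ominus> f) \<ominus> f" using car s a by algebra
      also have "\<dots> = s \<oplus> f \<ominus> f" by (simp only: ae)
      also have "\<dots> = s" using car s a by algebra
      finally show ?thesis ..
    qed
    ultimately show ?thesis unfolding xb using e0 by (intro conj_sum_eq_trace_sum)
  qed
  moreover have "gl.conj_sum (?y \<otimes>\<^bsub>GL2 R\<^esub> ?b) = trace_sum (\<ominus> (s \<oplus> (e \<oplus> f)))"
  proof -
    have "((\<ominus> \<one> \<ominus> a) \<otimes> e, \<ominus> ?\<beta> \<otimes> f, \<ominus> e, a \<otimes> f) \<in> carrier (SL2 R)"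
      using gl.subgroup_axioms y b yb by (metis subgroup.m_closed)
    moreover have "\<ominus> (s \<oplus> (e \<oplus> f)) = (\<ominus> \<one> \<ominus> a) \<otimes> e \<oplus> a \<otimes> f"
    proof -
      have "(\<ominus> \<one> \<ominus> a) \<otimes> e \<oplus> a \<otimes> f = \<ominus> e \<ominus> a \<otimes> (e \<ominus> f)" using car s a by algebra
      also have "\<dots> = \<ominus> e \<ominus> (s \<oplus> f)" by (simp only: ae)
      also have "\<dots> = \<ominus> (s \<oplus> (e \<oplus> f))" using car s a by algebra
      finally show ?thesis ..
    qed
    ultimately show ?thesis unfolding yb using e0' by (intro conj_sum_eq_trace_sum)
  qed
  moreover have "gl.conj_sum ?b + gl.conj_sum (?x \<otimes>\<^bsub>GL2 R\<^esub> ?b) + gl.conj_sum (?x \<otimes>\<^bsub>GL2 R\<^esub> ?x \<otimes>\<^bsub>GL2 R\<^esub> ?b)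
      \<in> scharlau_ideal gl.G"
    using x b yx by (intro gl.conj_sum_order3) (simp_all only: xx, simp_all)
  ultimately have sum: "gl.conj_sum ?b + trace_sum s + trace_sum (\<ominus> (s \<oplus> (e \<oplus> f))) \<in> \<J>"
    by (simp only: xx G_eq)
  have grp: "group (SL2 R)" "finite (carrier (SL2 R))"
    using SL2_group gl.fin_G by (simp_all)
  note add = group.scharlau_ideal_add[OF grp] and diff = group.scharlau_ideal_diff[OF grp]
  have neg: "trace_sum (\<ominus> (s \<oplus> (e \<oplus> f))) \<in> \<J>"
    using diff[OF sum add[OF trace_sum_split(1)[OF _ _ ef ne] ks]] by simp
  then show ?thesis
    using diff[OF trace_sum_uminus[OF two, of "s \<oplus> (e \<oplus> f)"] neg] by simp
qed

lemma trace_sum_multiple: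
  assumes two: "\<one> \<oplus> \<one> \<noteq> \<zero>"
    and ef: "e \<in> carrier R" "f \<in> carrier R" "e \<otimes> f = \<one>" "e \<noteq> f"
  shows "trace_sum ([Suc n] \<cdot> (e \<oplus> f)) \<in> \<J>"
proof (induction n)
  case 0
  then show ?case using trace_sum_split(2)[OF ef] ef by simp
next
  case (Suc n)
  then have "trace_sum ([Suc n] \<cdot> (e \<oplus> f) \<oplus> (e \<oplus> f)) \<in> \<J>"
    using ef by (intro trace_sum_shift[OF two]) auto
  then show ?case by (simp add: add.nat_pow_Suc)
qed

section \<open>The order as an element of the ideal\<close>

text \<open>
  Conjugation by \<open>diag (1, e)\<close> multiplies the entry of an element of \<open>U\<close> by \<open>e\<close>. Starting from
  the entry \<open>1\<close>, it reaches each non-trivial element of \<open>U\<close> exactly once. The matrices \<open>diag (1, e)\<close>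
  are also representatives of \<open>GL2\<close> modulo \<open>SL2\<close>, as their determinants are the non-zero \<open>e\<close>.
\<close>

lemma order_in_if_trace_sum_two_in:
  assumes k2: "trace_sum (\<one> \<oplus> \<one>) \<in> \<J>"
  shows "[order (SL2 R)] \<cdot>\<^bsub>int_group_ring (SL2 R)\<^esub> \<one>\<^bsub>int_group_ring (SL2 R)\<^esub> \<in> \<J>"
proof -
  let ?W = "(\<lambda>e. (\<one>, \<zero>, \<zero>, e)) ` (carrier R - {\<zero>})"
  let ?b = "(\<one>, \<zero>, \<one>, \<one>)"
  have b: "?b \<in> carrier (SL2 R)" by (simp add: minus_eq)
  have W: "?W \<subseteq> carrier (GL2 R)" by (auto simp: minus_eq)
  have inv: "inv e \<in> carrier R" "e \<otimes> inv e = \<one>" "inv e \<otimes> e = \<one>" if "e \<in> carrier R" "e \<noteq> \<zero>" for e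
    using that field_Units by auto
  have scale: "gl.conj_by (\<one>, \<zero>, \<zero>, e) ?b = (\<one>, \<zero>, e, \<one>)" if "e \<in> carrier R" "e \<noteq> \<zero>" for e
    using that by (intro gl.conj_by_eqI) (simp_all add: minus_eq)
  have 1: "bij_betw (\<lambda>w. gl.conj_by w ?b) ?W (U - {\<one>\<^bsub>GL2 R\<^esub>})"
    by (rule bij_betw_imageI) (auto simp: inj_on_def scale U_def image_iff)
  have mult: "(a, b, c, d) \<otimes>\<^bsub>GL2 R\<^esub> (\<one>, \<zero>, \<zero>, e) = (a, b \<otimes> e, c, d \<otimes> e)"
    if "a \<in> carrier R" "b \<in> carrier R" "c \<in> carrier R" "d \<in> carrier R" "e \<in> carrier R" for a b c d e
    using that by simp
  have detm: "a \<otimes> (d \<otimes> e) \<ominus> b \<otimes> e \<otimes> c = (a \<otimes> d \<ominus> b \<otimes> c) \<otimes> e"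
    if "a \<in> carrier R" "b \<in> carrier R" "c \<in> carrier R" "d \<in> carrier R" "e \<in> carrier R" for a b c d e
    using that by algebra
  have 2: "bij_betw (\<lambda>(g, w). g \<otimes>\<^bsub>GL2 R\<^esub> w) (carrier (SL2 R) \<times> ?W) (carrier (GL2 R))"
  proof (rule bij_betw_imageI)
    show "inj_on (\<lambda>(g, w). g \<otimes>\<^bsub>GL2 R\<^esub> w) (carrier (SL2 R) \<times> ?W)"
    proof (rule inj_onI, clarify, goal_cases)
      case (1 a b c d _ _ _ _ a' b' c' d' _ _ _ _ e e')
      then have *: "a = a'" "b \<otimes> e = b' \<otimes> e'" "c = c'" "d \<otimes> e = d' \<otimes> e'"
        by (simp_all add: mult)
      have det: "a \<otimes> d \<ominus> b \<otimes> c = \<one>" "a' \<otimes> d' \<ominus> b' \<otimes> c' = \<one>"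
        and car: "a \<in> carrier R" "b \<in> carrier R" "c \<in> carrier R" "d \<in> carrier R" "e \<in> carrier R"
          "a' \<in> carrier R" "b' \<in> carrier R" "c' \<in> carrier R" "d' \<in> carrier R" "e' \<in> carrier R"
        using 1 by simp_all
      have "e = a \<otimes> (d \<otimes> e) \<ominus> b \<otimes> e \<otimes> c" using car by (simp add: detm det)
      also have "\<dots> = a' \<otimes> (d' \<otimes> e') \<ominus> b' \<otimes> e' \<otimes> c'" by (simp only: *)
      also have "\<dots> = e'" using car by (simp add: detm det)
      finally show ?case using 1 * by (simp add: m_rcancel)
    qed
    show "(\<lambda>(g, w). g \<otimes>\<^bsub>GL2 R\<^esub> w) ` (carrier (SL2 R) \<times> ?W) = carrier (GL2 R)"
    proof
      show "(\<lambda>(g, w). g \<otimes>\<^bsub>GL2 R\<^esub> w) ` (carrier (SL2 R) \<times> ?W) \<subseteq> carrier (GL2 R)"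
        using W SL2_GL2 by (auto simp del: GL2_simps)
      show "carrier (GL2 R) \<subseteq> (\<lambda>(g, w). g \<otimes>\<^bsub>GL2 R\<^esub> w) ` (carrier (SL2 R) \<times> ?W)"
      proof
        fix x assume x: "x \<in> carrier (GL2 R)"
        obtain a b c d where xe: "x = (a, b, c, d)" by (cases x)
        with x have [simp]: "a \<in> carrier R" "b \<in> carrier R" "c \<in> carrier R" "d \<in> carrier R"
          and det: "a \<otimes> d \<ominus> b \<otimes> c \<noteq> \<zero>" by auto
        define e where "e = a \<otimes> d \<ominus> b \<otimes> c"
        have e [simp]: "e \<in> carrier R" "e \<noteq> \<zero>" using det by (auto simp: e_def)
        have "(a, b \<otimes> inv e, c, d \<otimes> inv e) \<in> carrier (SL2 R)"
          using inv[OF e] detm[of a b c d "inv e"] by (simp flip: e_def)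
        moreover have "x = (a, b \<otimes> inv e, c, d \<otimes> inv e) \<otimes>\<^bsub>GL2 R\<^esub> (\<one>, \<zero>, \<zero>, e)"
          using inv[OF e] by (simp add: xe m_assoc)
        moreover have "(\<one>, \<zero>, \<zero>, e) \<in> ?W" by simp
        ultimately show "x \<in> (\<lambda>(g, w). g \<otimes>\<^bsub>GL2 R\<^esub> w) ` (carrier (SL2 R) \<times> ?W)"
          by blast
      qed
    qed
  qed
  have "gl.conj_sum ?b \<in> scharlau_ideal gl.G"
    using k2 conj_sum_eq_trace_sum[OF b] by (simp add: G_eq)
  then show ?thesis
    using gl.order_in_if_conj_sum_in[OF subgroup_U U_nontrivial b W 2 1] by (simp only: G_eq)
qed

end

section \<open>Prime fields\<close>

lemma (in residues) res_add_pow: "[(n::nat)] \<cdot>\<^bsub>R\<^esub> x = (int n * x) mod m"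
proof (induction n)
  case 0
  then show ?case by (simp add: res_zero_eq)
next
  case (Suc n)
  then show ?case 
    by (simp add: add.nat_pow_Suc res_add_eq mod_simps algebra_simps)
qed

text \<open>
  The diagonal matrix is \<open>diag (2, 1 / 2)\<close>. Its entries differ because \<open>p \<noteq> 3\<close>, and its trace
  \<open>5 / 2\<close> is non-zero because \<open>p \<noteq> 5\<close>; for \<open>p = 5\<close> the shift by the trace would be void.
\<close>

theorem SL2_prime_field_order_in_scharlau_ideal:
  fixes p :: nat
  defines "G \<equiv> SL2 (residue_ring (int p))"
  assumes p: "prime p" and p7: "p \<ge> 7"
  shows "order G = (p - 1) * p * (p + 1) \<and>
    [order G] \<cdot>\<^bsub>int_group_ring G\<^esub> \<one>\<^bsub>int_group_ring G\<^esub> \<in> scharlau_ideal G"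
proof -
  define R where "R = residue_ring (int p)"
  interpret residues_prime p R
    by unfold_locales (use p in \<open>auto simp: R_def\<close>)
  interpret finite_field R
    using is_field by (intro finite_field.intro finite_field_axioms.intro finite)
  have car: "carrier R = {0..<int p}" by (auto simp: res_carrier_eq)
  have odd: "odd p" using prime_odd_nat[OF p] p7 by simp
  then obtain h where h: "p = 2 * h + 1" by (rule oddE)
  \<comment> \<open>Since \<open>p = 2 h + 1\<close>, the inverse of \<open>2\<close> is \<open>h + 1\<close>.\<close>
  define e f t where "e = (2 :: int)" and "f = int h + 1" and "t = int h + 3"
  have h3: "h \<ge> 3" using p7 h by simp
  have ef: "e \<in> carrier R" "f \<in> carrier R" using h h3 by (auto simp: car e_def f_def)
  have "e \<otimes>\<^bsub>R\<^esub> f = (1 + int p) mod int p"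
    by (simp add: res_mult_eq e_def f_def h algebra_simps)
  then have 1: "e \<otimes>\<^bsub>R\<^esub> f = \<one>\<^bsub>R\<^esub>" using p7 by (simp add: res_one_eq)
  have 2: "e \<noteq> f" using h3 by (simp add: e_def f_def)
  have two: "\<one>\<^bsub>R\<^esub> \<oplus>\<^bsub>R\<^esub> \<one>\<^bsub>R\<^esub> = 2" "\<zero>\<^bsub>R\<^esub> = 0"
    using p7 by (simp_all add: res_add_eq res_one_eq res_zero_eq)
  have et: "e \<oplus>\<^bsub>R\<^esub> f = t" using h h3 by (simp add: res_add_eq e_def f_def t_def)
  have "coprime t (int p)"
    using h h3 zdvd_not_zless[of t "int p"] by (intro p_coprime_right_int[THEN iffD2]) (simp add: t_def)
  then obtain j where j: "[t * j = 2] (mod int p)"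
    using cong_solve_coprime_int[of t "int p"] cong_scalar_right[of _ 1 "int p" 2]
    by (metis mult.assoc mult_1)
  define n where "n = nat (j mod int p)"
  have n: "(int n * t) mod int p = 2"
  proof -
    have "(int n * t) mod int p = (t * j) mod int p"
      using p7 by (simp add: n_def mod_simps mult.commute)
    then show ?thesis using j p7 by (simp add: cong_def)
  qed
  have "n \<noteq> 0"
  proof
    assume "n = 0"
    then show False using n by simp
  qed
  then obtain m where m: "n = Suc m" by (cases n) auto
  have "trace_sum ([Suc m] \<cdot>\<^bsub>R\<^esub> (e \<oplus>\<^bsub>R\<^esub> f)) \<in> \<J>"
    by (intro trace_sum_multiple ef 1 2) (simp add: two)
  then have "trace_sum (\<one>\<^bsub>R\<^esub> \<oplus>\<^bsub>R\<^esub> \<one>\<^bsub>R\<^esub>) \<in> \<J>"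
    using n by (simp add: res_add_pow two et m del: of_nat_Suc)
  then have "[order (SL2 R)] \<cdot>\<^bsub>int_group_ring (SL2 R)\<^esub> \<one>\<^bsub>int_group_ring (SL2 R)\<^esub> \<in> \<J>"
    by (rule order_in_if_trace_sum_two_in)
  moreover have "order (SL2 R) = (p - 1) * p * (p + 1)"
    by (simp add: order_SL2 car)
  ultimately show ?thesis by (simp add: G_def R_def)
qed

theorem mainTheorem1:
  fixes p :: nat
  defines "G \<equiv> SL2 (residue_ring (int p))"
  assumes "prime p" and "[p = 17] (mod 60)"
  shows "order G = (p - 1) * p * (p + 1) \<and>
    [order G] \<cdot>\<^bsub>int_group_ring G\<^esub> \<one>\<^bsub>int_group_ring G\<^esub> \<in> scharlau_ideal G"
proof -
  have "p mod 60 = 17" using assms(3) by (simp add: cong_def)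
  then have "p \<ge> 7" by presburger
  with assms(2) show ?thesis
    unfolding G_def by (rule SL2_prime_field_order_in_scharlau_ideal)
qed

end
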